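(* If $n\ge1$ and $P,Q\in\mathcal{H}_n$ are such that $Q\preccurlyeq P$, then $T[Q]\preccurlyeq T[P]$ for all operators $T\in\mathcal{A}$.
   Context: $\Pi=\mathbb{C}[x]$, and $\operatorname{End}\Pi$ is the set of linear operators on $\Pi$. $\mathcal{H}_n$ denotes the set of monic polynomials of degree $n$ all of whose zeros are real, with $\mathcal{H}_0=\{1\}$. $\mathcal{A}=\{T\in\operatorname{End}\Pi : T(\mathcal{H}_n)\subseteq\mathcal{H}_n\text{ for all integers }n\ge0\}$. (A known theorem of Carnicer, Peña and Pinkus states that $\mathcal{A}=\{\varphi(D):\varphi\in\mathcal{LP},\ \varphi(0)=1\}$, where $D=d/dx$, $\varphi(D)[P]=\sum_k a_kP^{(k)}$ if $\varphi(x)=\sum_ka_kx^k$, and $\mathcal{LP}$ is the Laguerre-Pólya class of real entire functions $cx^me^{-a^2x^2+bx}\prod_{k=1}^\infty(1-\alpha_kx)e^{\alpha_kx}$ with $a,b,c,\alpha_k\in\mathbb{R}$, $c\neq0$, $m$ a nonnegative integer, $\sum_k\alpha_k^2<\infty$.) $\mathcal{Z}(P)$ is the unordered tuple of zeros of $P$ counted with multiplicity. Spectral order: for unordered real $n$-tuples $X,Y$ write $X\prec Y$ if $\sum_{i=1}^n f(x_i)\le\sum_{i=1}^n f(y_i)$ for every convex $f:\mathbb{R}\to\mathbb{R}$ (equivalently, $X=AY$ as column vectors for some doubly stochastic matrix $A$); for $P,Q\in\mathcal{H}_n$ write $Q\preccurlyeq P$ if $\mathcal{Z}(Q)\prec\mathcal{Z}(P)$.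 *)

theory Defs
  imports "HOL-Analysis.Analysis" "HOL-Computational_Algebra.Computational_Algebra"
begin

definition hyperbolic_polys :: "nat \<Rightarrow> complex poly set" where
  "hyperbolic_polys n =
     {P. degree P = n \<and> lead_coeff P = 1 \<and> (\<forall>z. poly P z = 0 \<longrightarrow> z \<in> \<real>)}"

lemma hyperbolic_polys_0: "hyperbolic_polys 0 = {1}"
  by (auto simp: hyperbolic_polys_def elim!: degree_eq_zeroE)

definition hyperbolicity_preservers :: "(complex poly \<Rightarrow> complex poly) set" where
  "hyperbolicity_preservers =
     {T. Vector_Spaces.linear smult smult T \<and>
         (\<forall>n. T ` hyperbolic_polys n \<subseteq> hyperbolic_polys n)}"

text \<open>
  The unordered tuple of zeros is the multiset \<open>proots P\<close>. Convex functions on the real line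
  are applied to it, so the zeros are transported to type \<open>real\<close> by \<open>Re\<close>; this loses
  nothing on \<open>hyperbolic_polys n\<close>, the only place where \<open>real_zeros\<close> is meaningful.
\<close>

definition real_zeros :: "complex poly \<Rightarrow> real multiset" where
  "real_zeros P = image_mset Re (proots P)"

lemma of_real_real_zeros:
  assumes "P \<in> hyperbolic_polys n"
  shows "image_mset complex_of_real (real_zeros P) = proots P" and "size (real_zeros P) = n"
proof -
  have "P \<noteq> 0" using assms by (auto simp: hyperbolic_polys_def)
  then have "image_mset (\<lambda>z. complex_of_real (Re z)) (proots P) = image_mset (\<lambda>z. z) (proots P)"
    using assms by (intro image_mset_cong) (auto simp: hyperbolic_polys_def)
  then show "image_mset complex_of_real (real_zeros P) = proots P"
    by (simp add: real_zeros_def multiset.map_comp o_def)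
  show "size (real_zeros P) = n"
    using assms by (simp add: real_zeros_def size_proots_complex hyperbolic_polys_def)
qed

definition majorized :: "real multiset \<Rightarrow> real multiset \<Rightarrow> bool"  (infix \<open>\<prec>\<^sub>m\<close> 50) where
  "X \<prec>\<^sub>m Y \<longleftrightarrow> size X = size Y \<and>
     (\<forall>f. convex_on UNIV f \<longrightarrow> (\<Sum>x\<in>#X. f x) \<le> (\<Sum>y\<in>#Y. f y))"

definition spectral_le :: "complex poly \<Rightarrow> complex poly \<Rightarrow> bool"  (infix \<open>\<preceq>\<^sub>s\<close> 50) where
  "Q \<preceq>\<^sub>s P \<longleftrightarrow> real_zeros Q \<prec>\<^sub>m real_zeros P"

end

theory Submission
  imports Defs "HOL-Real_Asymp.Real_Asymp"
begin

text \<open>A preserver \<open>T\<close> commutes with \<open>D = d/dx\<close>: otherwise, for the least \<open>n\<close> with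
  \<open>T x\<^sup>n \<noteq> \<phi>(D) x\<^sup>n\<close>, the translates of \<open>T (x - s)\<^sup>n\<close> would have zeros whose squares have
  bounded sum but whose coefficients are unbounded in \<open>s\<close>. If \<open>r\<^sub>j\<close> are the zeros of \<open>T x\<^sup>N\<close>, the
  products of \<open>1 - (r\<^sub>j / N) D\<close> over \<open>j < N\<close> converge to \<open>T\<close> as \<open>N\<close> grows, and the spectral order
  is closed under limits. This leaves the operators \<open>1 - a D\<close>. If \<open>P\<close> has zeros \<open>x\<close>, the zeros
  of \<open>P - a P'\<close> are the eigenvalues of \<open>diag(x) + a J\<close> with \<open>J\<close> the all-ones matrix. A vector
  majorized by \<open>x\<close> arises from \<open>x\<close> by averaging with transposed copies; as \<open>J\<close> is invariant under
  permutations, this averages conjugates of the matrix, and \<open>M \<mapsto> tr f(M)\<close> is convex for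
  convex \<open>f\<close>. Distinct zeros, for which the eigenvectors are explicit, suffice by a perturbation.\<close>

section \<open>Eigenvalues of a diagonal matrix plus a multiple of the all-ones matrix\<close>

text \<open>The Gram matrix \<open>S\<close> of the columns is symmetric, and row orthonormality
  makes it idempotent, so row \<open>k\<close> of \<open>I - S\<close> has squared length
  \<open>1 - S k k\<close>. The trace of \<open>S\<close> is \<open>n\<close>, hence all these
  nonnegative defects vanish.\<close>

lemma orthonormal_rows_imp_columns:
  fixes v :: "nat \<Rightarrow> nat \<Rightarrow> real"
  assumes "\<And>i j. i < n \<Longrightarrow> j < n \<Longrightarrow> (\<Sum>k<n. v i k * v j k) = of_bool (i = j)"
  assumes "k < n" "l < n"
  shows "(\<Sum>j<n. v j k * v j l) = of_bool (k = l)"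
proof -
  define S where "S k l = (\<Sum>j<n. v j k * v j l)" for k l
  have defect: "(\<Sum>l<n. (of_bool (k = l) - S k l)\<^sup>2) = 1 - S k k" if "k < n" for k
  proof -
    have "(\<Sum>l<n. (S k l)\<^sup>2) = (\<Sum>l<n. \<Sum>j<n. \<Sum>i<n. v j k * v i k * (v j l * v i l))"
      by (simp add: S_def power2_eq_square sum_product mult_ac)
    also have "\<dots> = (\<Sum>j<n. \<Sum>i<n. \<Sum>l<n. v j k * v i k * (v j l * v i l))"
      by (subst sum.swap, rule sum.cong[OF refl], rule sum.swap)
    also have "\<dots> = (\<Sum>j<n. \<Sum>i<n. v j k * v i k * of_bool (j = i))"
      by (intro sum.cong refl) (simp add: assms(1) flip: sum_distrib_left)
    also have "\<dots> = S k k"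
      by (simp add: S_def of_bool_def if_distrib[of "\<lambda>x. _ * x"] cong: if_cong)
    finally have "(\<Sum>l<n. (S k l)\<^sup>2) = S k k" .
    moreover have "(\<Sum>l<n. (of_bool (k = l) - S k l)\<^sup>2) =
        (\<Sum>l<n. (if k = l then 1 - 2 * S k l else 0) + (S k l)\<^sup>2)"
      by (intro sum.cong) (auto simp: power2_eq_square algebra_simps)
    ultimately show ?thesis
      using that by (simp add: sum.distrib)
  qed
  have "(\<Sum>k<n. S k k) = (\<Sum>j<n. \<Sum>k<n. v j k * v j k)"
    unfolding S_def by (rule sum.swap)
  also have "\<dots> = n" by (simp add: assms(1))
  finally have "(\<Sum>k<n. \<Sum>l<n. (of_bool (k = l) - S k l)\<^sup>2) = 0"
    by (simp add: defect sum_subtractf)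
  then have "(of_bool (k = l) - S k l)\<^sup>2 = 0"
    using assms(2,3) by (simp add: sum_nonneg_eq_0_iff sum_nonneg)
  then show ?thesis by (simp add: S_def)
qed

definition orthonormal :: "nat \<Rightarrow> (nat \<Rightarrow> nat \<Rightarrow> real) \<Rightarrow> bool" where
  "orthonormal n v \<longleftrightarrow> (\<forall>i<n. \<forall>j<n. (\<Sum>k<n. v i k * v j k) = of_bool (i = j))"

text \<open>The quadratic form of the matrix \<open>diag(x) + a J\<close> with \<open>J\<close> the all-ones matrix.\<close>

definition qform :: "nat \<Rightarrow> real \<Rightarrow> (nat \<Rightarrow> real) \<Rightarrow> (nat \<Rightarrow> real) \<Rightarrow> real" where
  "qform n a x u = (\<Sum>k<n. x k * (u k)\<^sup>2) + a * (\<Sum>k<n. u k)\<^sup>2"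

definition eigenbasis ::
  "nat \<Rightarrow> real \<Rightarrow> (nat \<Rightarrow> real) \<Rightarrow> (nat \<Rightarrow> real) \<Rightarrow> (nat \<Rightarrow> nat \<Rightarrow> real) \<Rightarrow> bool" where
  "eigenbasis n a x l v \<longleftrightarrow> orthonormal n v \<and>
     (\<forall>j<n. \<forall>k<n. x k * v j k + a * (\<Sum>i<n. v j i) = l j * v j k)"

lemma orthonormal_columns:
  assumes "orthonormal n v" "k < n" "l < n"
  shows "(\<Sum>j<n. v j k * v j l) = of_bool (k = l)"
  by (rule orthonormal_rows_imp_columns) (use assms in \<open>auto simp: orthonormal_def\<close>)

lemma qform_eigenvector:
  assumes "eigenbasis n a x l v" "j < n"
  shows "qform n a x (v j) = l j"
proof -
  have "qform n a x (v j) = (\<Sum>k<n. (x k * v j k + a * (\<Sum>i<n. v j i)) * v j k)"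
    by (simp add: qform_def ring_distribs sum.distrib power2_eq_square mult.assoc
             flip: sum_distrib_left)
  also have "\<dots> = l j * (\<Sum>k<n. v j k * v j k)"
    using assms by (simp add: eigenbasis_def mult.assoc flip: sum_distrib_left)
  also have "\<dots> = l j"
    using assms by (simp add: eigenbasis_def orthonormal_def)
  finally show ?thesis .
qed

lemma parseval:
  assumes "orthonormal n v"
  shows "(\<Sum>j<n. (\<Sum>k<n. w k * v j k)\<^sup>2) = (\<Sum>k<n. (w k)\<^sup>2)"
proof -
  have "(\<Sum>j<n. (\<Sum>k<n. w k * v j k)\<^sup>2) =
      (\<Sum>j<n. \<Sum>k<n. \<Sum>l<n. w k * w l * (v j k * v j l))"
    by (simp add: power2_eq_square sum_product mult_ac)
  also have "\<dots> = (\<Sum>k<n. \<Sum>l<n. \<Sum>j<n. w k * w l * (v j k * v j l))"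
    by (subst sum.swap, rule sum.cong[OF refl], rule sum.swap)
  also have "\<dots> = (\<Sum>k<n. \<Sum>l<n. w k * w l * of_bool (k = l))"
    by (intro sum.cong refl) (simp add: orthonormal_columns[OF assms] flip: sum_distrib_left)
  also have "\<dots> = (\<Sum>k<n. (w k)\<^sup>2)"
    by (simp add: of_bool_def if_distrib[of "\<lambda>x. _ * x"] power2_eq_square cong: if_cong)
  finally show ?thesis .
qed

text \<open>Spectral decomposition: \<open>entry\<close> recovers the matrix entries from
  \<open>l\<close> and \<open>v\<close> by orthonormality of the columns.\<close>

lemma qform_spectral:
  assumes eb: "eigenbasis n a x l v"
  shows "qform n a x w = (\<Sum>j<n. (\<Sum>k<n. w k * v j k)\<^sup>2 * l j)"
proof -
  have orth: "orthonormal n v" using eb by (simp add: eigenbasis_def)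
  have entry: "(\<Sum>j<n. l j * v j k * v j m) = x k * of_bool (k = m) + a" if "k < n" "m < n" for k m
  proof -
    have "(\<Sum>j<n. l j * v j k * v j m) = (\<Sum>j<n. (x k * v j k + a * (\<Sum>i<n. v j i)) * v j m)"
      using eb that by (intro sum.cong) (auto simp: eigenbasis_def)
    also have "\<dots> = x k * (\<Sum>j<n. v j k * v j m) + a * (\<Sum>j<n. \<Sum>i<n. v j i * v j m)"
      by (simp add: ring_distribs sum.distrib sum_distrib_left sum_distrib_right mult_ac)
    also have "(\<Sum>j<n. \<Sum>i<n. v j i * v j m) = (\<Sum>i<n. \<Sum>j<n. v j i * v j m)"
      by (rule sum.swap)
    also have "\<dots> = 1"
      using that by (simp add: orthonormal_columns[OF orth] of_bool_def)
    finally show ?thesis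
      using that by (simp add: orthonormal_columns[OF orth])
  qed
  have "(\<Sum>j<n. (\<Sum>k<n. w k * v j k)\<^sup>2 * l j) =
      (\<Sum>j<n. \<Sum>k<n. \<Sum>m<n. w k * w m * (l j * v j k * v j m))"
    unfolding power2_eq_square sum_product unfolding sum_distrib_right by (simp add: mult_ac)
  also have "\<dots> = (\<Sum>k<n. \<Sum>m<n. \<Sum>j<n. w k * w m * (l j * v j k * v j m))"
    by (subst sum.swap, rule sum.cong[OF refl], rule sum.swap)
  also have "\<dots> = (\<Sum>k<n. \<Sum>m<n. w k * w m * (x k * of_bool (k = m) + a))"
    by (intro sum.cong refl) (simp add: entry flip: sum_distrib_left)
  also have "\<dots> = (\<Sum>k<n. \<Sum>m<n. (if k = m then x k * (w k)\<^sup>2 else 0) + a * (w k * w m))"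
    by (intro sum.cong refl) (auto simp: power2_eq_square algebra_simps)
  also have "\<dots> = qform n a x w"
    unfolding qform_def sum.distrib power2_eq_square sum_product sum_distrib_left[of a] by simp
  finally show ?thesis by simp
qed

text \<open>Convexity of \<open>M \<mapsto> tr f(M)\<close>, restricted to matrices of the form \<open>diag(y) + a J\<close>: averaging \<open>y\<close> with a transposed copy of itself
  averages the matrix with a permutation conjugate of itself.\<close>

definition trace_bounded ::
  "nat \<Rightarrow> real \<Rightarrow> (real \<Rightarrow> real) \<Rightarrow> real \<Rightarrow> (nat \<Rightarrow> real) \<Rightarrow> bool" where
  "trace_bounded n a f B y \<longleftrightarrow>
     (\<forall>u. orthonormal n u \<longrightarrow> (\<Sum>i<n. f (qform n a y (u i))) \<le> B)"

text \<open>The values of the form on an orthonormal system are averages of the eigenvalues with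
  doubly stochastic weights \<open>K\<close>, so Jensen along the rows and unit column sums suffice.
  By \<open>qform_eigenvector\<close> the eigenbasis attains the bound.\<close>

lemma trace_bounded_eigenvalues:
  assumes eb: "eigenbasis n a x l v" and f: "convex_on UNIV f"
  shows "trace_bounded n a f (\<Sum>j<n. f (l j)) x"
  unfolding trace_bounded_def
proof (intro allI impI)
  fix u assume u: "orthonormal n u"
  define K where "K i j = (\<Sum>k<n. u i k * v j k)\<^sup>2" for i j
  have v: "orthonormal n v" using eb by (simp add: eigenbasis_def)
  have row: "(\<Sum>j<n. K i j) = 1" if "i < n" for i
    using parseval[OF v, of "u i"] u that by (simp add: K_def orthonormal_def power2_eq_square)
  have col: "(\<Sum>i<n. K i j) = 1" if "j < n" for j
    using parseval[OF u, of "v j"] v that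
    by (simp add: K_def orthonormal_def power2_eq_square mult.commute)
  have "(\<Sum>i<n. f (qform n a x (u i))) = (\<Sum>i<n. f (\<Sum>j<n. K i j *\<^sub>R l j))"
    by (simp add: qform_spectral[OF eb] K_def)
  also have "\<dots> \<le> (\<Sum>i<n. \<Sum>j<n. K i j * f (l j))"
    by (intro sum_mono convex_on_sum[OF _ _ f]) (auto simp: row, auto simp: K_def)
  also have "\<dots> = (\<Sum>j<n. (\<Sum>i<n. K i j) * f (l j))"
    by (subst sum.swap) (simp add: sum_distrib_right)
  also have "\<dots> = (\<Sum>j<n. f (l j))" by (simp add: col)
  finally show "(\<Sum>i<n. f (qform n a x (u i))) \<le> (\<Sum>j<n. f (l j))" .
qed

lemma sum_transpose:
  assumes "i < n" "j < n"
  shows "(\<Sum>k<n. g (Transposition.transpose i j k)) = (\<Sum>k<n. g k)"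
  by (rule sum.reindex_bij_betw)
    (use assms in \<open>auto simp: bij_betw_def inj_on_def transpose_image_eq dest: transpose_eq_imp_eq\<close>)

lemma trace_bounded_pinch:
  assumes tb: "trace_bounded n a f B y" and f: "convex_on UNIV f"
    and ij: "i < n" "j < n" and c: "0 \<le> c" "c \<le> 1"
  shows "trace_bounded n a f B (\<lambda>k. c * y k + (1 - c) * y (Transposition.transpose i j k))"
  unfolding trace_bounded_def
proof (intro allI impI)
  fix u assume u: "orthonormal n u"
  define s where "s = Transposition.transpose i j"
  have ss: "s (s k) = k" for k by (simp add: s_def)
  have reindex: "(\<Sum>k<n. g (s k)) = (\<Sum>k<n. g k)" for g :: "nat \<Rightarrow> real"
    unfolding s_def by (rule sum_transpose[OF ij])
  have us: "orthonormal n (\<lambda>i. u i \<circ> s)"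
    using u reindex[of "\<lambda>k. u _ k * u _ k"] by (simp add: orthonormal_def)
  \<comment> \<open>The permutation \<open>s\<close> leaves the all-ones term unchanged, so it can
    be moved from \<open>y\<close> to the test vector \<open>w\<close>.\<close>
  have split: "qform n a (\<lambda>k. c * y k + (1 - c) * y (s k)) w =
      (1 - c) * qform n a y (w \<circ> s) + c * qform n a y w" for w
  proof -
    have "(\<Sum>k<n. y (s k) * (w k)\<^sup>2) = (\<Sum>k<n. y k * (w (s k))\<^sup>2)"
      using reindex[of "\<lambda>k. y k * (w (s k))\<^sup>2"] by (simp add: ss)
    then show ?thesis
      using reindex[of w]
      by (simp add: qform_def sum.distrib ring_distribs mult.assoc sum_subtractf flip: sum_distrib_left)
  qed
  have "(\<Sum>i<n. f (qform n a (\<lambda>k. c * y k + (1 - c) * y (s k)) (u i))) \<le>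
      (\<Sum>i<n. (1 - c) * f (qform n a y (u i \<circ> s)) + c * f (qform n a y (u i)))"
    unfolding split
    by (intro sum_mono) (use convex_onD[OF f c(1,2)] in simp)
  also have "\<dots> = (1 - c) * (\<Sum>i<n. f (qform n a y (u i \<circ> s))) + c * (\<Sum>i<n. f (qform n a y (u i)))"
    by (simp add: sum.distrib sum_distrib_left)
  also have "\<dots> \<le> (1 - c) * B + c * B"
    using tb u us c unfolding trace_bounded_def
    by (intro add_mono mult_left_mono) auto
  finally show "(\<Sum>h<n. f (qform n a (\<lambda>k. c * y k + (1 - c) * y (Transposition.transpose i j k)) (u h))) \<le> B"
    by (simp add: s_def left_diff_distrib)
qed

lemma trace_bounded_cong:
  assumes "\<And>k. k < n \<Longrightarrow> y k = z k"
  shows "trace_bounded n a f B y \<longleftrightarrow> trace_bounded n a f B z"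
  using assms by (simp add: trace_bounded_def qform_def)

section \<open>Majorization and pinches\<close>

definition maj :: "nat \<Rightarrow> (nat \<Rightarrow> real) \<Rightarrow> (nat \<Rightarrow> real) \<Rightarrow> bool" where
  "maj n y x \<longleftrightarrow> (\<forall>f. convex_on UNIV f \<longrightarrow> (\<Sum>i<n. f (y i)) \<le> (\<Sum>i<n. f (x i)))"

lemma majD: "maj n y x \<Longrightarrow> convex_on UNIV f \<Longrightarrow> (\<Sum>i<n. f (y i)) \<le> (\<Sum>i<n. f (x i))"
  by (simp add: maj_def)

lemma convex_on_pos_part: "convex_on UNIV (\<lambda>t::real. max 0 (t - c))"
proof (intro convex_onI)
  fix t x y :: real assume t: "0 < t" "t < 1"
  have "(1 - t) *\<^sub>R x + t *\<^sub>R y - c = (1 - t) * (x - c) + t * (y - c)"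
    by (simp add: algebra_simps)
  also have "\<dots> \<le> (1 - t) * max 0 (x - c) + t * max 0 (y - c)"
    using t by (intro add_mono mult_left_mono) auto
  finally show "max 0 ((1 - t) *\<^sub>R x + t *\<^sub>R y - c) \<le> (1 - t) * max 0 (x - c) + t * max 0 (y - c)"
    using t by (auto intro!: add_nonneg_nonneg mult_nonneg_nonneg)
qed auto

lemma maj_sum_eq:
  assumes "maj n y x"
  shows "(\<Sum>i<n. y i) = (\<Sum>i<n. x i)"
proof (rule antisym)
  have "convex_on UNIV (\<lambda>t::real. t)" "convex_on UNIV (\<lambda>t::real. - t)"
    by (auto intro!: convex_onI simp: algebra_simps)
  then show "(\<Sum>i<n. y i) \<le> (\<Sum>i<n. x i)" "(\<Sum>i<n. x i) \<le> (\<Sum>i<n. y i)"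
    using assms by (force simp: maj_def sum_negf)+
qed

text \<open>Test with the hinge at the \<open>k\<close>-th largest entry \<open>x m\<close>: on
  \<open>x\<close> it equals \<open>x i - x m\<close> for the first \<open>k\<close> indices and 0
  afterwards, while every \<open>y i\<close> is at most \<open>x m\<close> plus its hinge
  value.\<close>

lemma maj_prefix_le:
  assumes maj: "maj n y x" and x: "antimono_on {..<n} x" and k: "k \<le> n"
  shows "(\<Sum>i<k. y i) \<le> (\<Sum>i<k. x i)"
proof (cases k)
  case (Suc m)
  define f where "f t = max 0 (t - x m)" for t
  have sub: "{..<k} \<subseteq> {..<n}" using k by auto
  have "(\<Sum>i<k. y i) \<le> (\<Sum>i<k. x m + f (y i))"
    by (intro sum_mono) (auto simp: f_def)
  also have "\<dots> = k * x m + (\<Sum>i<k. f (y i))" by (simp add: sum.distrib)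
  also have "(\<Sum>i<k. f (y i)) \<le> (\<Sum>i<n. f (y i))"
    using sub by (intro sum_mono2) (auto simp: f_def)
  also have "\<dots> \<le> (\<Sum>i<n. f (x i))"
    unfolding f_def by (rule majD[OF maj convex_on_pos_part])
  also have "\<dots> = (\<Sum>i<k. f (x i))"
    using x Suc k by (intro sum.mono_neutral_right sub) (auto simp: f_def monotone_on_def)
  also have "\<dots> = (\<Sum>i<k. x i - x m)"
    using x Suc k by (intro sum.cong) (auto simp: f_def monotone_on_def max_def)
  also have "k * x m + \<dots> = (\<Sum>i<k. x i)" by (simp add: sum_subtractf)
  finally show ?thesis by simp
qed auto

text \<open>Hardy--Littlewood--Polya: move mass between an index \<open>i\<close> with \<open>x i > y i\<close> and the first
  index \<open>j > i\<close> with \<open>x j < y j\<close> until one of the two coordinates agrees with \<open>y\<close>. Only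
  \<open>y\<close> has to be ordered, so the intermediate vectors need not be resorted.\<close>

lemma pinch_induct:
  fixes x y :: "nat \<Rightarrow> real"
  assumes "antimono_on {..<n} y"
    and "\<And>k. k \<le> n \<Longrightarrow> (\<Sum>i<k. y i) \<le> (\<Sum>i<k. x i)"
    and "(\<Sum>i<n. y i) = (\<Sum>i<n. x i)"
    and "R x"
    and pinch: "\<And>z i j c. R z \<Longrightarrow> i < n \<Longrightarrow> j < n \<Longrightarrow> 0 \<le> c \<Longrightarrow> c \<le> 1 \<Longrightarrow>
      R (\<lambda>k. c * z k + (1 - c) * z (Transposition.transpose i j k))"
    and cong: "\<And>z w. R z \<Longrightarrow> (\<And>k. k < n \<Longrightarrow> z k = w k) \<Longrightarrow> R w"
  shows "R y"
  using assms(2-4)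
proof (induction "card {i. i < n \<and> x i \<noteq> y i}" arbitrary: x rule: less_induct)
  case less
  show ?case
  proof (cases "\<forall>i<n. x i = y i")
    case True
    then show ?thesis using cong less.prems by blast
  next
    case False
    have "\<exists>j<n. x j < y j"
    proof (rule ccontr)
      assume "\<not> ?thesis"
      then have "\<And>j. j < n \<Longrightarrow> y j \<le> x j" by force
      then have "y j = x j" if "j < n" for j
        using less.prems(2) that by (intro sum_mono_inv[of y "{..<n}" x]) auto
      then show False using False by auto
    qed
    then obtain j where j: "j < n" "x j < y j" and first: "\<And>k. k < j \<Longrightarrow> \<not> (k < n \<and> x k < y k)"
      using exists_least_iff[of "\<lambda>j. j < n \<and> x j < y j"] by auto
    then have ge: "y k \<le> x k" if "k < j" for k
      using that by force
    \<comment> \<open>Otherwise the prefix of length \<open>Suc j\<close> would have a smaller sum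
      in \<open>x\<close> than in \<open>y\<close>.\<close>
    have "\<exists>i<j. y i < x i"
    proof (rule ccontr)
      assume "\<not> ?thesis"
      then have "(\<Sum>i<j. x i) \<le> (\<Sum>i<j. y i)" by (intro sum_mono) force
      then have "(\<Sum>i<Suc j. x i) < (\<Sum>i<Suc j. y i)" using j by simp
      then show False using less.prems(1)[of "Suc j"] j by simp
    qed
    then obtain i where i: "i < j" "y i < x i" by blast
    have yij: "y j \<le> y i" using assms(1) i j by (auto simp: monotone_on_def)
    \<comment> \<open>The largest transfer from \<open>i\<close> to \<open>j\<close> that overshoots
      neither target; \<open>c\<close> solves \<open>(1 - c) * (x i - x j) = d\<close>. Since
      \<open>y j <= y i\<close>, \<open>d\<close> is at most \<open>x i - x j\<close>, so
      \<open>c\<close> lies in the unit interval.\<close>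
    define d where "d = min (x i - y i) (y j - x j)"
    define c where "c = 1 - d / (x i - x j)"
    define z where "z = (\<lambda>k. c * x k + (1 - c) * x (Transposition.transpose i j k))"
    have d: "0 < d" "d \<le> x i - y i" "d \<le> y j - x j" using i j by (auto simp: d_def)
    have pos: "x i - x j > 0" using d yij by linarith
    have c: "0 \<le> c" "c \<le> 1" using d yij pos by (auto simp: c_def field_simps)
    have cd: "(1 - c) * (x i - x j) = d" using pos by (simp add: c_def)
    have zi: "z i = x i - d" using cd by (simp add: z_def algebra_simps)
    have zj: "z j = x j + d" using cd by (simp add: z_def algebra_simps)
    have zk: "z k = x k" if "k \<noteq> i" "k \<noteq> j" for k
      using that by (simp add: z_def algebra_simps)
    have zsum: "(\<Sum>k<m. z k) = (\<Sum>k<m. x k) - (if i < m then d else 0) + (if j < m then d else 0)" for m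
    proof -
      have "z k = x k - (if k = i then d else 0) + (if k = j then d else 0)" for k
        using zi zj zk i by (cases "k = i"; cases "k = j") auto
      then have "(\<Sum>k<m. z k) = (\<Sum>k<m. x k - (if k = i then d else 0) + (if k = j then d else 0))"
        by simp
      then show ?thesis by (simp add: sum.distrib sum_subtractf)
    qed
    show ?thesis
    proof (rule less.hyps[of z])
      have "{k. k < n \<and> z k \<noteq> y k} \<subset> {k. k < n \<and> x k \<noteq> y k}"
      proof
        show "{k. k < n \<and> z k \<noteq> y k} \<subseteq> {k. k < n \<and> x k \<noteq> y k}"
        proof (intro Collect_mono impI)
          fix k assume k: "k < n \<and> z k \<noteq> y k"
          then show "k < n \<and> x k \<noteq> y k"
            using zk[of k] i j by (cases "k = i \<or> k = j") auto
        qed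
        have "z i = y i \<or> z j = y j" using zi zj unfolding d_def min_def by argo
        then have "\<exists>k<n. z k = y k \<and> x k \<noteq> y k"
        proof
          assume "z i = y i"
          then show ?thesis using i j by (intro exI[of _ i]) linarith
        next
          assume "z j = y j"
          then show ?thesis using i j by (intro exI[of _ j]) linarith
        qed
        then show "{k. k < n \<and> z k \<noteq> y k} \<noteq> {k. k < n \<and> x k \<noteq> y k}" by blast
      qed
      then show "card {k. k < n \<and> z k \<noteq> y k} < card {k. k < n \<and> x k \<noteq> y k}"
        by (intro psubset_card_mono) auto
      show "(\<Sum>k<n. y k) = (\<Sum>k<n. z k)"
        using less.prems(2) i j by (simp add: zsum)
      show "R z" unfolding z_def by (rule pinch) (use less.prems i j c in auto)
      fix m assume m: "m \<le> n"
      show "(\<Sum>k<m. y k) \<le> (\<Sum>k<m. z k)"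
      \<comment> \<open>Only prefixes containing \<open>i\<close> but not \<open>j\<close> lose
        \<open>d\<close>. All terms before \<open>j\<close> satisfy \<open>y k <= x k\<close>, so
        the surplus at \<open>i\<close> alone pays for it.\<close>
      proof (cases "i < m \<and> m \<le> j")
        case True
        have "(\<Sum>k\<in>{i}. x k - y k) \<le> (\<Sum>k<m. x k - y k)"
          using True ge by (intro sum_mono2) auto
        then show ?thesis using True d by (simp add: zsum sum_subtractf)
      next
        case False
        then have "(\<Sum>k<m. z k) = (\<Sum>k<m. x k)" using i by (auto simp: zsum)
        then show ?thesis using less.prems(1)[OF m] by simp
      qed
    qed
  qed
qed

text \<open>Prefix sums replace \<open>maj\<close> in the hypotheses because they survive adding one
  common vector to \<open>x\<close> and \<open>y\<close>. Pinches carry the trace bound from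
  \<open>x\<close> to \<open>y\<close>, where it is tested on the eigenbasis of
  \<open>y\<close>.\<close>

lemma maj_eigenvalues:
  assumes y: "antimono_on {..<n} y"
    and prefix: "\<And>k. k \<le> n \<Longrightarrow> (\<Sum>i<k. y i) \<le> (\<Sum>i<k. x i)"
    and total: "(\<Sum>i<n. y i) = (\<Sum>i<n. x i)"
    and ex: "eigenbasis n a x l v" and ey: "eigenbasis n a y m u"
  shows "maj n m l"
  unfolding maj_def
proof (intro allI impI)
  fix f :: "real \<Rightarrow> real" assume f: "convex_on UNIV f"
  have "trace_bounded n a f (\<Sum>j<n. f (l j)) y"
  proof (rule pinch_induct[where R = "trace_bounded n a f (\<Sum>j<n. f (l j))"])
    show "trace_bounded n a f (\<Sum>j<n. f (l j)) x"
      by (rule trace_bounded_eigenvalues[OF ex f])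
    show "trace_bounded n a f (\<Sum>j<n. f (l j)) w"
      if "trace_bounded n a f (\<Sum>j<n. f (l j)) z" "\<And>k. k < n \<Longrightarrow> z k = w k" for z w
      using that trace_bounded_cong[of n z w] by blast
  qed (rule y prefix total trace_bounded_pinch[OF _ f] | assumption)+
  moreover have "orthonormal n u" using ey by (simp add: eigenbasis_def)
  ultimately have "(\<Sum>i<n. f (qform n a y (u i))) \<le> (\<Sum>i<n. f (l i))"
    by (simp add: trace_bounded_def)
  then show "(\<Sum>i<n. f (m i)) \<le> (\<Sum>i<n. f (l i))"
    by (simp add: qform_eigenvector[OF ey])
qed

section \<open>Zeros of a polynomial minus a multiple of its derivative\<close>

definition root_poly :: "nat \<Rightarrow> (nat \<Rightarrow> real) \<Rightarrow> complex poly" where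
  "root_poly n x = (\<Prod>i<n. [:- complex_of_real (x i), 1:])"

lemma root_poly_Suc: "root_poly (Suc n) x = root_poly n x * [:- complex_of_real (x n), 1:]"
  by (simp add: root_poly_def)

lemma coeff_root_poly_Suc:
  "coeff (root_poly (Suc n) x) (Suc i) =
    coeff (root_poly n x) i - of_real (x n) * coeff (root_poly n x) (Suc i)"
  "coeff (root_poly (Suc n) x) 0 = - of_real (x n) * coeff (root_poly n x) 0"
  by (simp_all add: root_poly_Suc)

lemma root_poly_nonzero [simp]: "root_poly n x \<noteq> 0"
  by (simp add: root_poly_def)

lemma degree_root_poly [simp]: "degree (root_poly n x) = n"
  unfolding root_poly_def by (subst degree_prod_sum_eq) auto

lemma lead_coeff_root_poly [simp]: "coeff (root_poly n x) n = 1"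
  using lead_coeff_prod[of "\<lambda>i. [:- complex_of_real (x i), 1:]" "{..<n}"]
    degree_root_poly[of n x]
  by (simp add: root_poly_def)

lemma poly_root_poly: "poly (root_poly n x) z = (\<Prod>i<n. z - of_real (x i))"
  by (simp add: root_poly_def poly_prod)

lemma root_poly_in_hyperbolic: "root_poly n x \<in> hyperbolic_polys n"
  by (auto simp: hyperbolic_polys_def poly_root_poly)

lemma real_zeros_root_poly: "real_zeros (root_poly n x) = image_mset x (mset_set {..<n})"
proof (induction n)
  case 0
  then show ?case by (simp add: real_zeros_def root_poly_def)
next
  case (Suc n)
  have "proots (root_poly (Suc n) x) = proots (root_poly n x) + {#complex_of_real (x n)#}"
    unfolding root_poly_Suc by (subst proots_mult) auto
  then show ?case using Suc by (simp add: real_zeros_def lessThan_Suc)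
qed

lemma spectral_le_root_poly: "root_poly n y \<preceq>\<^sub>s root_poly n x \<longleftrightarrow> maj n y x"
  by (simp add: spectral_le_def majorized_def real_zeros_root_poly maj_def
      image_mset.compositionality o_def sum_unfold_sum_mset)

lemma hyperbolic_root_poly:
  assumes "P \<in> hyperbolic_polys n"
  obtains x where "P = root_poly n x" "antimono_on {..<n} x"
proof -
  define xs where "xs = rev (sorted_list_of_multiset (real_zeros P))"
  have xs: "mset xs = real_zeros P" "length xs = n" "sorted (rev xs)"
    using of_real_real_zeros[OF assms] by (simp_all add: xs_def flip: size_mset)
  have "P = smult (lead_coeff P) (\<Prod>x\<in>#proots P. [:- x, 1:])"
    by (rule complex_poly_decompose_multiset [symmetric])
  also have "\<dots> = (\<Prod>x\<in>#mset xs. [:- complex_of_real x, 1:])"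
    using assms of_real_real_zeros(1)[OF assms, symmetric] xs(1)
    by (auto simp: hyperbolic_polys_def image_mset.compositionality o_def)
  also have "\<dots> = (\<Prod>x\<leftarrow>xs. [:- complex_of_real x, 1:])"
    by (metis mset_map prod_mset_prod_list)
  also have "\<dots> = root_poly n (\<lambda>i. xs ! i)"
    using xs(2) by (simp add: root_poly_def prod.list_conv_set_nth atLeast0LessThan)
  finally have "P = root_poly n (\<lambda>i. xs ! i)" .
  moreover have "antimono_on {..<n} (\<lambda>i. xs ! i)"
    using xs(2,3) by (auto simp: monotone_on_def sorted_rev_iff_nth_mono)
  ultimately show ?thesis using that by blast
qed

section \<open>Logarithmic derivative and the secular equation\<close>

lemma pderiv_root_poly:
  "pderiv (root_poly n x) = (\<Sum>i<n. \<Prod>j\<in>{..<n} - {i}. [:- complex_of_real (x j), 1:])"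
  by (simp add: root_poly_def pderiv_prod pderiv_pCons)

lemma poly_pderiv_root_poly:
  assumes "\<And>i. i < n \<Longrightarrow> z \<noteq> of_real (x i)"
  shows "poly (pderiv (root_poly n x)) z =
    poly (root_poly n x) z * (\<Sum>i<n. 1 / (z - of_real (x i)))"
proof -
  have "(\<Prod>j\<in>{..<n} - {i}. z - of_real (x j)) =
      poly (root_poly n x) z * (1 / (z - of_real (x i)))" if "i < n" for i
    using assms[OF that] that
    by (simp add: poly_root_poly prod.remove[of "{..<n}" i "\<lambda>j. z - of_real (x j)"])
  then show ?thesis
    by (simp add: pderiv_root_poly poly_sum poly_prod sum_distrib_left)
qed

lemma poly_pderiv_root_poly_root:
  assumes "i < n"
  shows "poly (pderiv (root_poly n x)) (of_real (x i)) =
    (\<Prod>j\<in>{..<n} - {i}. of_real (x i - x j))"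
proof -
  have "(\<Prod>j\<in>{..<n} - {k}. complex_of_real (x i) - of_real (x j)) = 0" if "k < n" "k \<noteq> i" for k
    using that assms by (auto intro!: bexI[of _ i])
  then have "(\<Sum>k<n. \<Prod>j\<in>{..<n} - {k}. complex_of_real (x i) - of_real (x j)) =
      (\<Sum>k\<in>{i}. \<Prod>j\<in>{..<n} - {k}. complex_of_real (x i) - of_real (x j))"
    using assms by (intro sum.mono_neutral_right) auto
  then show ?thesis
    by (simp add: pderiv_root_poly poly_sum poly_prod)
qed

text \<open>Each term has imaginary part \<open>- Im z / |z - x i|^2\<close>, so off the real axis
  all terms have the same strict sign.\<close>

lemma Im_sum_recip:
  fixes x :: "nat \<Rightarrow> real"
  assumes "n > 0" "\<And>i. i < n \<Longrightarrow> z \<noteq> complex_of_real (x i)"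
    and "Im (\<Sum>i<n. 1 / (z - of_real (x i))) = 0"
  shows "Im z = 0"
proof (rule ccontr)
  assume "Im z \<noteq> 0"
  have "(\<Sum>i<n. Im (1 / (z - of_real (x i)))) = - Im z * (\<Sum>i<n. 1 / (cmod (z - of_real (x i)))\<^sup>2)"
    unfolding sum_distrib_left
    by (intro sum.cong refl) (simp add: Im_divide cmod_power2)
  moreover have "(\<Sum>i<n. 1 / (cmod (z - of_real (x i)))\<^sup>2) > 0"
    using assms(1,2) by (intro sum_pos) auto
  ultimately show False using assms(3) \<open>Im z \<noteq> 0\<close> by simp
qed

text \<open>Differentiate the logarithmic derivative identity, which holds on a neighbourhood of
  \<open>z\<close>. This serves to exclude double zeros of \<open>P - a P'\<close>.\<close>

lemma poly_pderiv2_root_poly: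
  assumes "\<And>i. i < n \<Longrightarrow> z \<noteq> of_real (x i)"
  shows "poly (pderiv (pderiv (root_poly n x))) z =
    poly (pderiv (root_poly n x)) z * (\<Sum>i<n. 1 / (z - of_real (x i)))
    - poly (root_poly n x) z * (\<Sum>i<n. 1 / (z - of_real (x i))\<^sup>2)"
proof (rule DERIV_unique)
  let ?U = "- (complex_of_real ` x ` {..<n})"
  have "open ?U" by (intro open_Compl finite_imp_closed) auto
  moreover have "z \<in> ?U" using assms by auto
  ultimately have "eventually (\<lambda>w. w \<in> ?U) (nhds z)"
    by (rule eventually_nhds_in_open)
  then have ev: "eventually (\<lambda>w. poly (pderiv (root_poly n x)) w =
      poly (root_poly n x) w * (\<Sum>i<n. 1 / (w - of_real (x i)))) (nhds z)"
    by eventually_elim (rule poly_pderiv_root_poly, auto)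
  have "((\<lambda>w. 1 / (w - of_real (x i))) has_field_derivative - (1 / (z - of_real (x i))\<^sup>2)) (at z)"
    if "i < n" for i
    using assms[OF that] by (auto intro!: derivative_eq_intros simp: power2_eq_square)
  then have "((\<lambda>w. \<Sum>i<n. 1 / (w - of_real (x i))) has_field_derivative
      (\<Sum>i<n. - (1 / (z - of_real (x i))\<^sup>2))) (at z)"
    by (intro DERIV_sum) auto
  from DERIV_mult[OF poly_DERIV this]
  have "((\<lambda>w. poly (root_poly n x) w * (\<Sum>i<n. 1 / (w - of_real (x i)))) has_field_derivative
    poly (pderiv (root_poly n x)) z * (\<Sum>i<n. 1 / (z - of_real (x i)))
    - poly (root_poly n x) z * (\<Sum>i<n. 1 / (z - of_real (x i))\<^sup>2)) (at z)"
    by (simp add: sum_negf algebra_simps)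
  then show "(poly (pderiv (root_poly n x)) has_field_derivative
    poly (pderiv (root_poly n x)) z * (\<Sum>i<n. 1 / (z - of_real (x i)))
    - poly (root_poly n x) z * (\<Sum>i<n. 1 / (z - of_real (x i))\<^sup>2)) (at z)"
    using DERIV_cong_ev[OF refl ev refl] by simp
qed (rule poly_DERIV)

text \<open>The zeros of \<open>P - a P'\<close>, with \<open>P\<close> having the distinct zeros \<open>x\<close>, are the eigenvalues of
  \<open>diag(x) + a J\<close>; the eigenvector for \<open>l\<close> is \<open>(1 / (l - x k))\<^sub>k\<close>.\<close>

lemma root_poly_minus_pderiv:
  fixes x :: "nat \<Rightarrow> real"
  assumes inj: "inj_on x {..<n}" and a: "a \<noteq> 0"
  obtains l v where "root_poly n x - smult (of_real a) (pderiv (root_poly n x)) = root_poly n l"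
    "eigenbasis n a x l v"
proof (cases "n = 0")
  case True
  then show ?thesis
    by (intro that[of x]) (auto simp: root_poly_def eigenbasis_def orthonormal_def)
next
  case False
  define P where "P = root_poly n x"
  define F where "F = P - smult (of_real a) (pderiv P)"
  \<comment> \<open>Distinctness of \<open>x\<close> makes \<open>P'\<close> nonzero at the zeros of
    \<open>P\<close>, so \<open>F\<close> and \<open>P\<close> share no zero; dividing
    \<open>F z = 0\<close> by \<open>P z\<close> leaves the secular equation of
    \<open>diag(x) + a J\<close>.\<close>
  have root: "(\<forall>i<n. z \<noteq> of_real (x i)) \<and> (\<Sum>i<n. 1 / (z - of_real (x i))) = 1 / of_real a"
    if z: "poly F z = 0" for z
  proof -
    have ne: "z \<noteq> of_real (x i)" if "i < n" for i
    proof
      assume eq: "z = of_real (x i)"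
      then have "poly P z = 0" using that by (auto simp: P_def poly_root_poly)
      then have "poly (pderiv P) z = 0" using z a by (simp add: F_def)
      then have "(\<Prod>j\<in>{..<n} - {i}. complex_of_real (x i - x j)) = 0"
        using poly_pderiv_root_poly_root[OF that, of x] eq by (simp add: P_def)
      then show False using inj that by (auto simp: inj_on_def)
    qed
    have "poly P z \<noteq> 0" using ne by (simp add: P_def poly_root_poly)
    moreover have "poly P z = of_real a * (poly P z * (\<Sum>i<n. 1 / (z - of_real (x i))))"
      using z poly_pderiv_root_poly[OF ne] by (simp add: F_def P_def)
    ultimately show ?thesis using ne a by (simp add: field_simps)
  qed
  have "degree (pderiv P) < n" using False by (simp add: P_def degree_pderiv)
  then have deg: "degree (- smult (of_real a) (pderiv P)) < degree P"
    using a by (simp add: P_def)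
  have "degree F = n \<and> lead_coeff F = 1"
    using degree_add_eq_left[OF deg] lead_coeff_add_le[OF deg] deg
    by (simp add: F_def P_def coeff_eq_0)
  moreover have "z \<in> \<real>" if "poly F z = 0" for z
    using root[OF that] Im_sum_recip[of n z x] False by (simp add: complex_is_Real_iff)
  ultimately have "F \<in> hyperbolic_polys n" by (auto simp: hyperbolic_polys_def)
  then obtain l where l: "F = root_poly n l"
    by (rule hyperbolic_root_poly)
  have root_l: "poly F (of_real (l j)) = 0" if "j < n" for j
    using that by (auto simp: l poly_root_poly)
  have ne: "l j \<noteq> x k" if "j < n" "k < n" for j k
    using root[OF root_l] that by auto
  have sum: "(\<Sum>k<n. 1 / (l j - x k)) = 1 / a" if "j < n" for j
  proof -
    have "complex_of_real (\<Sum>k<n. 1 / (l j - x k)) = of_real (1 / a)"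
      using root[OF root_l[OF that]] by simp
    then show ?thesis unfolding of_real_eq_iff .
  qed
  \<comment> \<open>The squared norm of the eigenvector for \<open>l j\<close> before normalisation;
    it reappears in \<open>P''\<close> at \<open>l j\<close>.\<close>
  define s where "s j = (\<Sum>k<n. 1 / (l j - x k)\<^sup>2)" for j
  have s: "s j > 0" if "j < n" for j
    unfolding s_def using ne[OF that] False by (intro sum_pos) auto
  \<comment> \<open>A double zero gives \<open>P = a P'\<close> and \<open>P' = a P''\<close>; the
    formula for \<open>P''\<close> then leaves \<open>a P s = 0\<close>, although all three factors
    are nonzero.\<close>
  have inj_l: "l i \<noteq> l j" if "i < n" "j < n" "i \<noteq> j" for i j
  proof
    assume eq: "l i = l j"
    let ?z = "complex_of_real (l i)"
    have "(\<Prod>k\<in>{..<n} - {i}. complex_of_real (l i - l k)) = 0"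
      using that eq by (auto intro!: bexI[of _ j])
    then have dF: "poly (pderiv F) ?z = 0"
      using poly_pderiv_root_poly_root[OF that(1), of l] by (simp add: l)
    have neC: "?z \<noteq> of_real (x k)" if "k < n" for k using ne[OF \<open>i < n\<close> that] by simp
    have S: "(\<Sum>k<n. 1 / (?z - of_real (x k))) = 1 / of_real a"
      using root[OF root_l[OF that(1)]] by simp
    have dP: "poly (pderiv P) ?z = poly P ?z / of_real a"
      using poly_pderiv_root_poly[of n ?z x] neC S by (simp add: P_def)
    have "poly (pderiv (pderiv P)) ?z = poly (pderiv P) ?z / of_real a - poly P ?z * of_real (s i)"
      using poly_pderiv2_root_poly[of n ?z x] neC S by (simp add: P_def s_def)
    moreover have "poly (pderiv P) ?z = of_real a * poly (pderiv (pderiv P)) ?z"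
      using dF by (simp add: F_def pderiv_diff pderiv_smult)
    ultimately have "of_real a * poly P ?z * of_real (s i) = 0"
      using a by (simp add: field_simps)
    moreover have "poly P ?z \<noteq> 0" using neC by (simp add: P_def poly_root_poly)
    ultimately show False using a s[OF that(1)] by simp
  qed
  define v where "v j k = 1 / (sqrt (s j) * (l j - x k))" for j k
  have "orthonormal n v"
    unfolding orthonormal_def
  proof (intro allI impI)
    fix i j assume ij: "i < n" "j < n"
    show "(\<Sum>k<n. v i k * v j k) = of_bool (i = j)"
    proof (cases "i = j")
      case True
      have vv: "v j k * v j k = 1 / s j * (1 / (l j - x k)\<^sup>2)" for k
        using s[OF ij(2)] by (simp add: v_def power2_eq_square)
      have "(\<Sum>k<n. v j k * v j k) = 1 / s j * s j"
        unfolding vv sum_distrib_left[symmetric] by (simp only: s_def[of j])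
      then show ?thesis using True s[OF ij(2)] by simp
    next
      case False
      \<comment> \<open>Partial fractions: both resulting sums equal \<open>1 / a\<close> and
        cancel.\<close>
      have "v i k * v j k =
          (1 / (l j - x k) - 1 / (l i - x k)) * (1 / (sqrt (s i) * sqrt (s j) * (l i - l j)))"
        if "k < n" for k
        using ne[OF ij(1) that] ne[OF ij(2) that] s ij inj_l[OF ij False]
        by (simp add: v_def divide_simps)
      then have "(\<Sum>k<n. v i k * v j k) =
          (\<Sum>k<n. 1 / (l j - x k) - 1 / (l i - x k)) * (1 / (sqrt (s i) * sqrt (s j) * (l i - l j)))"
        by (simp add: sum_divide_distrib)
      also have "(\<Sum>k<n. 1 / (l j - x k) - 1 / (l i - x k)) = 0"
        using sum ij by (simp add: sum_subtractf)
      finally show ?thesis using False by simp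
    qed
  qed
  moreover have "x k * v j k + a * (\<Sum>i<n. v j i) = l j * v j k" if "j < n" "k < n" for j k
  proof -
    have "(\<Sum>i<n. v j i) = 1 / sqrt (s j) * (\<Sum>i<n. 1 / (l j - x i))"
      by (simp add: v_def sum_distrib_left)
    then have "a * (\<Sum>i<n. v j i) = 1 / sqrt (s j)" using sum[OF that(1)] a by simp
    moreover have "(l j - x k) * v j k = 1 / sqrt (s j)"
      using ne[OF that] by (simp add: v_def)
    ultimately show ?thesis by (simp add: algebra_simps)
  qed
  ultimately have "eigenbasis n a x l v" by (simp add: eigenbasis_def)
  then show ?thesis using that l by (simp add: F_def P_def)
qed

section \<open>Limits of real-rooted polynomials\<close>

lemma convergent_subseq_finite_family:
  fixes x :: "nat \<Rightarrow> nat \<Rightarrow> real"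
  assumes "\<And>i. i < n \<Longrightarrow> bounded (range (\<lambda>m. x m i))"
  shows "\<exists>r l. strict_mono r \<and> (\<forall>i<n. (\<lambda>m. x (r m) i) \<longlonglongrightarrow> l i)"
  using assms
proof (induction n)
  case 0
  then show ?case by (intro exI[of _ id]) (auto simp: strict_mono_def)
next
  case (Suc n)
  then obtain r l where r: "strict_mono r" "\<And>i. i < n \<Longrightarrow> (\<lambda>m. x (r m) i) \<longlonglongrightarrow> l i"
    by auto
  have "bounded (range (\<lambda>m. x (r m) n))"
    using Suc.prems[of n] by (rule bounded_subset) auto
  then obtain t q where t: "strict_mono q" "((\<lambda>m. x (r m) n) \<circ> q) \<longlonglongrightarrow> t"
    using bounded_imp_convergent_subsequence by blast
  have "(\<lambda>m. x (r (q m)) i) \<longlonglongrightarrow> (l(n := t)) i" if "i < Suc n" for i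
    using LIMSEQ_subseq_LIMSEQ[OF r(2) t(1)] t(2) that
    by (cases "i = n") (auto simp: o_def)
  moreover have "strict_mono (r \<circ> q)" using r t by (simp add: strict_mono_o)
  ultimately show ?case by (intro exI[of _ "r \<circ> q"] exI[of _ "l(n := t)"]) (simp add: o_def)
qed

text \<open>Every factor of \<open>poly (root_poly n x) \<i>\<close> has modulus at least 1, so this one value
  controls each zero.\<close>

lemma abs_root_le: "i < n \<Longrightarrow> \<bar>x i\<bar> \<le> cmod (poly (root_poly n x) \<i>)"
proof -
  assume i: "i < n"
  have "\<bar>x i\<bar> \<le> cmod (\<i> - of_real (x i))"
    using abs_Re_le_cmod[of "\<i> - of_real (x i)"] by simp
  moreover have "1 \<le> cmod (\<i> - of_real (x j))" for j
    using abs_Im_le_cmod[of "\<i> - of_real (x j)"] by simp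
  then have "1 \<le> (\<Prod>j\<in>{..<n} - {i}. cmod (\<i> - of_real (x j)))"
    by (intro prod_ge_1) auto
  ultimately have "\<bar>x i\<bar> * 1 \<le> cmod (\<i> - of_real (x i)) * (\<Prod>j\<in>{..<n} - {i}. cmod (\<i> - of_real (x j)))"
    by (intro mult_mono) auto
  also have "\<dots> = cmod (poly (root_poly n x) \<i>)"
    using i prod.remove[of "{..<n}" i "\<lambda>j. cmod (\<i> - of_real (x j))"]
    by (simp add: poly_root_poly flip: prod_norm)
  finally show ?thesis by simp
qed

text \<open>Convergence at the single point \<i> already bounds all the zeros. A convergent
  subsequence of the zeros then identifies the limit polynomial, which is thereby
  real-rooted.\<close>

lemma root_poly_limit_subseq:
  assumes lim: "\<And>z. (\<lambda>m. poly (root_poly n (x m)) z) \<longlonglongrightarrow> poly P z"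
  obtains r l where "strict_mono r" "\<And>i. i < n \<Longrightarrow> (\<lambda>m. x (r m) i) \<longlonglongrightarrow> l i" "P = root_poly n l"
proof -
  have "bounded (range (\<lambda>m. poly (root_poly n (x m)) \<i>))"
    using lim by (intro convergent_imp_bounded)
  then obtain B where B: "\<And>m. cmod (poly (root_poly n (x m)) \<i>) \<le> B"
    by (auto simp: bounded_iff)
  have "bounded (range (\<lambda>m. x m i))" if "i < n" for i
    unfolding bounded_iff using order_trans[OF abs_root_le[OF that] B] by auto
  then obtain r l where r: "strict_mono r" and l: "\<And>i. i < n \<Longrightarrow> (\<lambda>m. x (r m) i) \<longlonglongrightarrow> l i"
    using convergent_subseq_finite_family[of n x] by blast
  have "poly P z = poly (root_poly n l) z" for z
  proof (rule LIMSEQ_unique)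
    show "(\<lambda>m. poly (root_poly n (x (r m))) z) \<longlonglongrightarrow> poly P z"
      using LIMSEQ_subseq_LIMSEQ[OF lim r] by (simp add: o_def)
    show "(\<lambda>m. poly (root_poly n (x (r m))) z) \<longlonglongrightarrow> poly (root_poly n l) z"
      unfolding poly_root_poly by (intro tendsto_intros l) auto
  qed
  then have "P = root_poly n l" by (simp add: poly_eq_poly_eq_iff[symmetric] fun_eq_iff)
  from that[OF r _ this] show ?thesis using l by blast
qed

text \<open>Convex functions on the whole line are continuous, so each convex inequality passes to
  the limit along a subsequence on which both tuples of zeros converge.\<close>

lemma spectral_le_limit:
  assumes x: "\<And>z. (\<lambda>m. poly (root_poly n (x m)) z) \<longlonglongrightarrow> poly P z"
    and y: "\<And>z. (\<lambda>m. poly (root_poly n (y m)) z) \<longlonglongrightarrow> poly Q z"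
    and le: "\<And>m. maj n (y m) (x m)"
  shows "Q \<preceq>\<^sub>s P"
proof -
  obtain r l where r: "strict_mono r" and l: "\<And>i. i < n \<Longrightarrow> (\<lambda>m. x (r m) i) \<longlonglongrightarrow> l i"
    and P: "P = root_poly n l"
    using root_poly_limit_subseq[OF x] by metis
  have "(\<lambda>m. poly (root_poly n (y (r m))) z) \<longlonglongrightarrow> poly Q z" for z
    using LIMSEQ_subseq_LIMSEQ[OF y r] by (simp add: o_def)
  then obtain q k where q: "strict_mono q" and k: "\<And>i. i < n \<Longrightarrow> (\<lambda>m. y (r (q m)) i) \<longlonglongrightarrow> k i"
    and Q: "Q = root_poly n k"
    using root_poly_limit_subseq[of n "\<lambda>m. y (r m)" Q] by metis
  have l': "(\<lambda>m. x (r (q m)) i) \<longlonglongrightarrow> l i" if "i < n" for i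
    using LIMSEQ_subseq_LIMSEQ[OF l q] that by (simp add: o_def)
  have "(\<Sum>i<n. f (k i)) \<le> (\<Sum>i<n. f (l i))" if f: "convex_on UNIV f" for f :: "real \<Rightarrow> real"
  proof (rule LIMSEQ_le)
    have "continuous_on UNIV f" using f by (intro convex_on_continuous) auto
    then have cont: "isCont f t" for t by (simp add: continuous_on_eq_continuous_at)
    show "(\<lambda>m. \<Sum>i<n. f (y (r (q m)) i)) \<longlonglongrightarrow> (\<Sum>i<n. f (k i))"
      by (intro tendsto_sum isCont_tendsto_compose[OF cont] k) auto
    show "(\<lambda>m. \<Sum>i<n. f (x (r (q m)) i)) \<longlonglongrightarrow> (\<Sum>i<n. f (l i))"
      by (intro tendsto_sum isCont_tendsto_compose[OF cont] l') auto
  qed (use le f in \<open>auto simp: maj_def\<close>)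
  then show ?thesis by (simp add: P Q spectral_le_root_poly maj_def)
qed

lemma tendsto_poly_pderiv_root_poly:
  assumes "\<And>i. i < n \<Longrightarrow> (\<lambda>m. x m i) \<longlonglongrightarrow> l i"
  shows "(\<lambda>m. poly (root_poly n (x m) - smult c (pderiv (root_poly n (x m)))) z)
    \<longlonglongrightarrow> poly (root_poly n l - smult c (pderiv (root_poly n l))) z"
  unfolding pderiv_root_poly poly_diff poly_smult poly_sum poly_prod poly_root_poly
  by (simp, intro tendsto_intros assms) auto

lemma minus_pderiv_preserves:
  fixes a :: real
  assumes P: "P \<in> hyperbolic_polys n" and Q: "Q \<in> hyperbolic_polys n" and le: "Q \<preceq>\<^sub>s P"
  defines "A \<equiv> \<lambda>R. R - smult (complex_of_real a) (pderiv R)"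
  shows "A P \<in> hyperbolic_polys n" "A Q \<in> hyperbolic_polys n" "A Q \<preceq>\<^sub>s A P"
proof -
  obtain x where x: "P = root_poly n x" "antimono_on {..<n} x"
    using P by (rule hyperbolic_root_poly)
  obtain y where y: "Q = root_poly n y" "antimono_on {..<n} y"
    using Q by (rule hyperbolic_root_poly)
  have maj: "maj n y x" using le by (simp add: x(1) y(1) spectral_le_root_poly)
  have "A P \<in> hyperbolic_polys n \<and> A Q \<in> hyperbolic_polys n \<and> A Q \<preceq>\<^sub>s A P"
  proof (cases "a = 0")
    case True
    then show ?thesis using P Q le by (simp add: A_def)
  next
    case False
    \<comment> \<open>This shift decreases strictly in \<open>i\<close> and is common to both
      vectors: it keeps their order, makes the entries distinct, changes corresponding prefix sums
      equally, and vanishes as \<open>m\<close> grows.\<close>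
    define d where "d m i = - real i / real (Suc m)" for m i
    have d0: "(\<lambda>m. t i + d m i) \<longlonglongrightarrow> t i" for t :: "nat \<Rightarrow> real" and i
      unfolding d_def by real_asymp
    have anti: "antimono_on {..<n} (\<lambda>i. t i + d m i)" if "antimono_on {..<n} t" for t m
    proof (rule monotone_onI)
      fix i j assume "i \<in> {..<n}" "j \<in> {..<n}" "i \<le> j"
      then have "t j \<le> t i" "d m j \<le> d m i"
        using that by (auto simp: monotone_on_def d_def divide_right_mono)
      then show "t i + d m i \<ge> t j + d m j" by simp
    qed
    have inj: "inj_on (\<lambda>i. t i + d m i) {..<n}" if "antimono_on {..<n} t" for t m
    proof (rule linorder_inj_onI)
      fix i j assume "i < j" "i \<in> {..<n}" "j \<in> {..<n}"
      then have "t j \<le> t i" "d m j < d m i"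
        using that by (auto simp: monotone_on_def d_def divide_strict_right_mono)
      then show "t i + d m i \<noteq> t j + d m j" by simp
    qed auto
    have "\<exists>l v. A (root_poly n (\<lambda>i. x i + d m i)) = root_poly n l \<and>
        eigenbasis n a (\<lambda>i. x i + d m i) l v" for m
      using root_poly_minus_pderiv[OF inj[OF x(2)] False] unfolding A_def by metis
    then obtain l v where l: "\<And>m. A (root_poly n (\<lambda>i. x i + d m i)) = root_poly n (l m)"
      and v: "\<And>m. eigenbasis n a (\<lambda>i. x i + d m i) (l m) (v m)" by metis
    have "\<exists>l v. A (root_poly n (\<lambda>i. y i + d m i)) = root_poly n l \<and>
        eigenbasis n a (\<lambda>i. y i + d m i) l v" for m
      using root_poly_minus_pderiv[OF inj[OF y(2)] False] unfolding A_def by metis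
    then obtain k u where k: "\<And>m. A (root_poly n (\<lambda>i. y i + d m i)) = root_poly n (k m)"
      and u: "\<And>m. eigenbasis n a (\<lambda>i. y i + d m i) (k m) (u m)" by metis
    have "maj n (k m) (l m)" for m
      by (rule maj_eigenvalues[OF anti[OF y(2)] _ _ v u])
        (use maj_prefix_le[OF maj x(2)] maj_sum_eq[OF maj] in \<open>auto simp: sum.distrib\<close>)
    moreover have lim: "(\<lambda>m. poly (root_poly n (l m)) z) \<longlonglongrightarrow> poly (A P) z"
      "(\<lambda>m. poly (root_poly n (k m)) z) \<longlonglongrightarrow> poly (A Q) z" for z
      using tendsto_poly_pderiv_root_poly[OF d0]
      unfolding l[symmetric] k[symmetric] x(1) y(1) A_def by auto
    ultimately have "A Q \<preceq>\<^sub>s A P" by (intro spectral_le_limit)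
    moreover have "A P \<in> hyperbolic_polys n" "A Q \<in> hyperbolic_polys n"
      using lim by (metis root_poly_limit_subseq root_poly_in_hyperbolic)+
    ultimately show ?thesis by simp
  qed
  then show "A P \<in> hyperbolic_polys n" "A Q \<in> hyperbolic_polys n" "A Q \<preceq>\<^sub>s A P" by auto
qed

section \<open>Hyperbolicity preservers as differential operators\<close>

text \<open>The operator \<open>\<phi>(D)\<close> for the power series with coefficients
  \<open>a\<close>, cut off after \<open>D^N\<close>; on degree at most \<open>N\<close> the cut
  loses nothing.\<close>

definition dop :: "(nat \<Rightarrow> complex) \<Rightarrow> nat \<Rightarrow> complex poly \<Rightarrow> complex poly" where
  "dop a N P = (\<Sum>k\<le>N. smult (a k) ((pderiv ^^ k) P))"

lemma dop_add: "dop a N (P + Q) = dop a N P + dop a N Q"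
  by (simp add: dop_def higher_pderiv_add smult_add_right sum.distrib)

lemma dop_smult: "dop a N (smult c P) = smult c (dop a N P)"
  by (simp add: dop_def higher_pderiv_smult poly_eq_iff coeff_sum sum_distrib_left mult_ac)

lemma dop_shift: "dop a N (pcompose P [:c, 1:]) = pcompose (dop a N P) [:c, 1:]"
proof -
  have "(pderiv ^^ k) (pcompose P [:c, 1:]) = pcompose ((pderiv ^^ k) P) [:c, 1:]" for k
    by (induction k) (simp_all add: pderiv_pcompose pderiv_pCons)
  then show ?thesis by (simp add: dop_def pcompose_sum pcompose_smult)
qed

lemma dop_degree_less:
  assumes "degree P < Suc n" "n \<le> N"
  shows "dop a N P = dop a n P"
proof -
  have "(pderiv ^^ k) P = 0" if "k > n" for k
  proof -
    have "coeff ((pderiv ^^ k) P) i = 0" for i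
      using assms(1) that by (simp add: coeff_higher_pderiv coeff_eq_0)
    then show ?thesis by (simp add: poly_eq_iff)
  qed
  then show ?thesis
    unfolding dop_def using assms(2) by (intro sum.mono_neutral_right) auto
qed

lemma linear_eq_dop:
  fixes T :: "complex poly \<Rightarrow> complex poly"
  assumes lin: "Vector_Spaces.linear smult smult T"
    and eq: "\<And>j. j \<le> d \<Longrightarrow> T (monom 1 j) = dop a N (monom 1 j)"
    and deg: "degree P \<le> d"
  shows "T P = dop a N P"
proof -
  interpret T: Vector_Spaces.linear smult smult T by (rule lin)
  interpret D: module_hom smult smult "dop a N"
    by (auto simp: module_hom_iff dop_add dop_smult T.vs1.module_axioms)
  have "P = (\<Sum>j\<le>degree P. smult (coeff P j) (monom 1 j))"
    by (simp add: smult_monom poly_as_sum_of_monoms)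
  then have "T P = T (\<Sum>j\<le>degree P. smult (coeff P j) (monom 1 j))" by simp
  also have "\<dots> = (\<Sum>j\<le>degree P. smult (coeff P j) (T (monom 1 j)))"
    by (simp add: T.sum T.scale)
  also have "\<dots> = (\<Sum>j\<le>degree P. smult (coeff P j) (dop a N (monom 1 j)))"
    using deg by (intro sum.cong) (auto simp: eq)
  also have "\<dots> = dop a N (\<Sum>j\<le>degree P. smult (coeff P j) (monom 1 j))"
    by (simp add: D.sum D.scale)
  also have "\<dots> = dop a N P"
    by (simp add: smult_monom poly_as_sum_of_monoms)
  finally show ?thesis .
qed

text \<open>The factor is the falling factorial \<open>n (n-1) ... (n-j+1)\<close>. The cases
  \<open>j = 0\<close> and \<open>j = n\<close> pin down the leading and constant terms; fixed
  \<open>j\<close> with growing \<open>n\<close> enters the final limit.\<close>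

lemma coeff_dop_monom:
  assumes "j \<le> n"
  shows "coeff (dop a n (monom 1 n)) (n - j) = a j * pochhammer (of_nat (Suc (n - j))) j"
proof -
  have "coeff (dop a n (monom 1 n)) (n - j) =
      (\<Sum>k\<le>n. a k * (pochhammer (of_nat (Suc (n - j))) k * (if n = n - j + k then 1 else 0)))"
    by (simp add: dop_def coeff_sum coeff_higher_pderiv)
  also have "\<dots> = (\<Sum>k\<in>{j}. a k * pochhammer (of_nat (Suc (n - j))) k)"
    using assms by (intro sum.mono_neutral_cong_right) auto
  finally show ?thesis by simp
qed

section \<open>Vieta relations and rigidity under translation\<close>

lemma coeff_root_poly_penultimate:
  "n \<ge> 1 \<Longrightarrow> coeff (root_poly n r) (n - 1) = - of_real (\<Sum>i<n. r i)"
proof (induction n)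
  case (Suc n)
  then show ?case
    by (cases n) (auto simp: coeff_root_poly_Suc)
qed simp

text \<open>With the penultimate coefficient this expresses the sum of the squared zeros by
  coefficients, which bounds every zero.\<close>

lemma coeff_root_poly_second:
  "n \<ge> 2 \<Longrightarrow> 2 * coeff (root_poly n r) (n - 2) =
    of_real ((\<Sum>i<n. r i)\<^sup>2 - (\<Sum>i<n. (r i)\<^sup>2))"
proof (induction n)
  case (Suc n)
  show ?case
  proof (cases "n \<ge> 2")
    case True
    then obtain m where m: "n = Suc (Suc m)" by (metis add_2_eq_Suc le_Suc_ex)
    have "2 * coeff (root_poly (Suc n) r) (Suc n - 2) =
        2 * coeff (root_poly n r) (n - 2) - 2 * of_real (r n) * coeff (root_poly n r) (n - 1)"
      by (simp add: coeff_root_poly_Suc m algebra_simps)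
    also have "\<dots> = of_real ((\<Sum>i<n. r i)\<^sup>2 - (\<Sum>i<n. (r i)\<^sup>2)) + 2 * of_real (r n) * of_real (\<Sum>i<n. r i)"
      using Suc.IH True coeff_root_poly_penultimate[of n r] by simp
    also have "\<dots> = of_real ((\<Sum>i<Suc n. r i)\<^sup>2 - (\<Sum>i<Suc n. (r i)\<^sup>2))"
      by (simp add: power2_eq_square algebra_simps)
    finally show ?thesis .
  next
    case False
    then have "n = 1" using Suc.prems by simp
    then show ?thesis
      by (simp add: root_poly_def lessThan_Suc power2_eq_square algebra_simps)
  qed
qed simp

lemma pcompose_monom_linear: "pcompose (monom c j) q = smult c (q ^ j)"
  for q :: "complex poly"
  by (induction j) (simp_all add: monom_Suc pcompose_pCons monom_0 pcompose_const)

lemma coeff_pcompose_linear: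
  fixes H :: "complex poly"
  assumes "degree H \<le> m"
  shows "coeff (pcompose H [:s, 1:]) i = (\<Sum>j\<le>m. coeff H j * coeff ([:s, 1:] ^ j) i)"
proof -
  have "H = (\<Sum>j\<le>m. monom (coeff H j) j)"
    using assms by (rule poly_as_sum_of_monoms'[symmetric])
  then have "pcompose H [:s, 1:] = (\<Sum>j\<le>m. smult (coeff H j) ([:s, 1:] ^ j))"
    by (metis (no_types, lifting) pcompose_sum pcompose_monom_linear sum.cong)
  then show ?thesis by (simp add: coeff_sum)
qed

lemma bounded_poly_const:
  fixes H :: "complex poly"
  assumes "\<And>s::real. cmod (poly H (of_real s)) \<le> B" "poly H 0 = 0"
  shows "H = 0"
proof (cases H)
  case (pCons a p)
  have "p = 0"
  proof (rule ccontr)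
    assume "p \<noteq> 0"
    then obtain r where r: "\<And>z. r \<le> cmod z \<Longrightarrow> B + 1 \<le> cmod (poly H z)"
      using poly_infinity[of p "B + 1" a] pCons by auto
    show False using r[of "of_real \<bar>r\<bar>"] assms(1)[of "\<bar>r\<bar>"] abs_ge_self[of r] by simp
  qed
  then show ?thesis using assms(2) pCons by simp
qed

text \<open>If \<open>q(x) + H(x + s)\<close> is real-rooted for all real \<open>s\<close>, then the sum \<open>R s\<close> of the squares of
  its zeros is affine in \<open>s\<close> and nonnegative, whence \<open>R s \<le> R s + R (- s) = 2 * R 0\<close>; so the zeros,
  and with them \<open>H\<close>, stay bounded.\<close>

lemma shifted_perturbation_zero:
  fixes q H :: "complex poly"
  assumes hyp: "\<And>s::real. q + pcompose H [:of_real s, 1:] \<in> hyperbolic_polys n"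
    and H: "degree H < n" "poly H 0 = 0"
  shows "H = 0"
proof (cases "n \<ge> 2")
  case False
  then have "degree H = 0" using H by simp
  then show ?thesis using H(2) by (auto elim!: degree_eq_zeroE)
next
  case True
  then obtain m where m: "n = Suc (Suc m)" by (metis add_2_eq_Suc le_Suc_ex)
  define F where "F s = q + pcompose H [:complex_of_real s, 1:]" for s :: real
  have "\<exists>r. F s = root_poly n r" for s
    using hyperbolic_root_poly[OF hyp[of s]] unfolding F_def by metis
  then obtain r where r: "\<And>s. F s = root_poly n (r s)" by metis
  define R where "R s = (\<Sum>i<n. (r s i)\<^sup>2)" for s
  have degH: "degree H \<le> Suc m" using H(1) m by simp
  \<comment> \<open>As \<open>H\<close> has degree below \<open>n\<close>, the translation leaves
    the coefficient of \<open>x^(n-1)\<close> independent of \<open>s\<close> and makes that of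
    \<open>x^(n-2)\<close> affine in \<open>s\<close>.\<close>
  have c1: "coeff (F s) (n - 1) = coeff q (Suc m) + coeff H (Suc m)" for s
    by (simp add: F_def m coeff_pcompose_linear[OF degH] coeff_eq_0 degree_linear_power coeff_linear_power)
  have c2: "coeff (F s) (n - 2) =
      coeff q m + coeff H m + of_nat (Suc m) * of_real s * coeff H (Suc m)" for s
  proof -
    have "(\<Sum>j<m. coeff H j * coeff ([:of_real s, 1:] ^ j) m) = 0"
      by (intro sum.neutral) (auto simp: coeff_eq_0 degree_linear_power)
    moreover have "coeff ([:of_real s, 1:] ^ Suc m) m = of_nat (Suc m) * complex_of_real s"
      by (subst coeff_linear_poly_power) auto
    ultimately show ?thesis
      by (simp add: F_def m coeff_pcompose_linear[OF degH] coeff_linear_power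
          del: power_Suc of_nat_Suc flip: lessThan_Suc_atMost)
  qed
  have R: "complex_of_real (R s) = (coeff (F s) (n - 1))\<^sup>2 - 2 * coeff (F s) (n - 2)" for s
    using coeff_root_poly_penultimate[of n "r s"] coeff_root_poly_second[of n "r s"] True
    by (simp add: r R_def)
  have "complex_of_real (R s + R (- s)) = of_real (2 * R 0)" for s
    unfolding of_real_add of_real_mult R c1 c2 by simp
  then have R2: "R s + R (- s) = 2 * R 0" for s unfolding of_real_eq_iff .
  have R0: "R s \<ge> 0" for s by (simp add: R_def sum_nonneg)
  have root: "\<bar>r s i\<bar> \<le> sqrt (2 * R 0)" if "i < n" for s i
  proof (rule real_le_rsqrt)
    have "(r s i)\<^sup>2 \<le> R s"
      unfolding R_def using that by (intro member_le_sum) auto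
    then show "\<bar>r s i\<bar>\<^sup>2 \<le> 2 * R 0" using R2[of s] R0[of "- s"] by simp
  qed
  show ?thesis
  proof (rule bounded_poly_const)
    fix s :: real
    \<comment> \<open>The value of \<open>F s\<close> at 0 is \<open>q(0) + H(s)\<close>, and up to
      sign it is the product of the zeros.\<close>
    have "cmod (poly (F s) 0) = (\<Prod>i<n. \<bar>r s i\<bar>)"
      by (simp add: r poly_root_poly flip: prod_norm)
    also have "\<dots> \<le> (\<Prod>i<n. sqrt (2 * R 0))"
      using root by (intro prod_mono) auto
    finally have "cmod (poly q 0 + poly H (of_real s)) \<le> sqrt (2 * R 0) ^ n"
      by (simp add: F_def poly_pcompose)
    then show "cmod (poly H (of_real s)) \<le> sqrt (2 * R 0) ^ n + cmod (poly q 0)"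
      using norm_triangle_ineq4[of "poly q 0 + poly H (of_real s)" "poly q 0"] by simp
  qed (rule H(2))
qed

lemma hyperbolic_shift:
  assumes "P \<in> hyperbolic_polys n"
  shows "pcompose P [:complex_of_real s, 1:] \<in> hyperbolic_polys n"
proof -
  have "lead_coeff (pcompose P [:complex_of_real s, 1:]) = 1"
    using assms by (subst lead_coeff_comp) (auto simp: hyperbolic_polys_def)
  moreover have "z \<in> \<real>" if "poly (pcompose P [:complex_of_real s, 1:]) z = 0" for z
  proof -
    have "of_real s + z \<in> \<real>"
      using assms that by (simp add: hyperbolic_polys_def poly_pcompose)
    from Reals_diff[OF this, of "of_real s"] show ?thesis by simp
  qed
  moreover have "degree (pcompose P [:complex_of_real s, 1:]) = n"
    using assms by (simp add: hyperbolic_polys_def degree_pcompose)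
  ultimately show ?thesis unfolding hyperbolic_polys_def by blast
qed

lemma degree_dop_le: "degree (dop a N P) \<le> degree P"
  unfolding dop_def
  by (intro degree_sum_le order_trans[OF degree_smult_le]) (auto simp: degree_higher_pderiv)

lemma monom_1_hyperbolic: "monom 1 n \<in> hyperbolic_polys n"
  by (auto simp: hyperbolic_polys_def degree_monom_eq poly_monom)

text \<open>By induction \<open>T\<close> agrees with \<open>dop\<close> below degree
  \<open>n\<close>, so on \<open>(x - s)^n\<close> the two differ by the same \<open>H\<close> for
  every \<open>s\<close>. Translating back gives the hyperbolic family \<open>q + H(x + s)\<close>.
  Dividing by \<open>fact k\<close> makes the constant terms match, so \<open>H\<close> vanishes at
  0, and \<open>a 0 = 1\<close> cancels the leading terms.\<close>

lemma preserver_monom_eq_dop: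
  assumes T: "T \<in> hyperbolicity_preservers"
  defines "a \<equiv> \<lambda>k. poly (T (monom 1 k)) 0 / fact k"
  shows "T (monom 1 n) = dop a n (monom 1 n)"
proof (induction n rule: less_induct)
  case (less n)
  have lin: "Vector_Spaces.linear smult smult T"
    using T by (simp add: hyperbolicity_preservers_def)
  have TH: "T P \<in> hyperbolic_polys m" if "P \<in> hyperbolic_polys m" for P m
    using T that by (auto simp: hyperbolicity_preservers_def)
  interpret T: Vector_Spaces.linear smult smult T by (rule lin)
  have "T (monom 1 0) = 1"
    using TH[OF monom_1_hyperbolic, of 0] by (simp add: hyperbolic_polys_0)
  then have a0: "a 0 = 1" by (simp add: a_def)
  show ?case
  proof (cases "n = 0")
    case True
    then show ?thesis using \<open>T (monom 1 0) = 1\<close> a0 by (simp add: dop_def monom_0 one_pCons)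
  next
    case False
    define q where "q = dop a n (monom 1 n)"
    define H where "H = T (monom 1 n) - q"
    have low: "T P = dop a n P" if "degree P < n" for P
    proof (rule linear_eq_dop[OF lin, of "n - 1"])
      fix j assume "j \<le> n - 1"
      then have "j < n" using False by simp
      then show "T (monom 1 j) = dop a n (monom 1 j)"
        using less.IH[of j] dop_degree_less[of "monom 1 j" j n a] by (simp add: degree_monom_eq)
    qed (use that in simp)
    have "H = 0"
    proof (rule shifted_perturbation_zero)
      fix s :: real
      define M where "M = pcompose (monom 1 n) [:- complex_of_real s, 1:]"
      have M: "M \<in> hyperbolic_polys n"
        using hyperbolic_shift[OF monom_1_hyperbolic, of n "- s"] by (simp add: M_def)
      have "degree (M - monom 1 n) < n"
      proof -
        have "degree (M - monom 1 n) \<le> n" "coeff (M - monom 1 n) n = 0"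
          using M by (auto simp: hyperbolic_polys_def degree_monom_eq intro!: degree_diff_le)
        then show ?thesis
          using False by (metis degree_0 le_neq_implies_less leading_coeff_0_iff neq0_conv)
      qed
      then have "T (M - monom 1 n) = dop a n (M - monom 1 n)" by (rule low)
      then have "T M = dop a n ((M - monom 1 n) + monom 1 n) + H"
        unfolding dop_add by (simp add: T.diff H_def q_def algebra_simps)
      then have "pcompose (T M) [:complex_of_real s, 1:] =
          dop a n (pcompose M [:complex_of_real s, 1:]) + pcompose H [:complex_of_real s, 1:]"
        by (simp add: pcompose_add dop_shift)
      also have "pcompose M [:complex_of_real s, 1:] =
          pcompose (monom 1 n) (pcompose [:- complex_of_real s, 1:] [:complex_of_real s, 1:])"
        unfolding M_def by (rule pcompose_assoc [symmetric])
      also have "pcompose [:- complex_of_real s, 1:] [:complex_of_real s, 1:] = [:0, 1:]"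
        by (simp add: pcompose_pCons)
      also have "pcompose (monom 1 n) [:0, 1:] = (monom 1 n :: complex poly)"
        by (rule pcompose_idR)
      finally show "q + pcompose H [:complex_of_real s, 1:] \<in> hyperbolic_polys n"
        using hyperbolic_shift[OF TH[OF M], of s] by (simp add: q_def)
    next
      have "degree H \<le> n"
        using TH[OF monom_1_hyperbolic, of n] degree_dop_le[of a n "monom 1 n"]
        by (auto simp: H_def q_def hyperbolic_polys_def degree_monom_eq intro!: degree_diff_le)
      moreover have "coeff H n = 0"
        using TH[OF monom_1_hyperbolic, of n] coeff_dop_monom[of 0 n a] a0
        by (auto simp: H_def q_def hyperbolic_polys_def)
      ultimately show "degree H < n"
        using False by (metis degree_0 le_neq_implies_less leading_coeff_0_iff neq0_conv)
      show "poly H 0 = 0"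
        using coeff_dop_monom[of n n a]
        by (simp add: H_def q_def a_def poly_0_coeff_0 flip: pochhammer_fact)
    qed
    then show ?thesis by (simp add: H_def q_def)
  qed
qed

lemma preserver_eq_dop:
  assumes T: "T \<in> hyperbolicity_preservers" and "degree P \<le> N"
  shows "T P = dop (\<lambda>k. poly (T (monom 1 k)) 0 / fact k) N P"
proof (rule linear_eq_dop)
  show "Vector_Spaces.linear smult smult T"
    using T by (simp add: hyperbolicity_preservers_def)
  fix j assume "j \<le> N"
  then show "T (monom 1 j) = dop (\<lambda>k. poly (T (monom 1 k)) 0 / fact k) N (monom 1 j)"
    using preserver_monom_eq_dop[OF T, of j] dop_degree_less[of "monom 1 j" j N]
    by (simp add: degree_monom_eq)
qed (rule assms(2))

section \<open>Approximation by products of first-order factors\<close>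

primrec linear_factors_op :: "real \<Rightarrow> (nat \<Rightarrow> real) \<Rightarrow> nat \<Rightarrow> complex poly \<Rightarrow> complex poly" where
  "linear_factors_op t r 0 P = P"
| "linear_factors_op t r (Suc m) P =
    linear_factors_op t r m P - smult (of_real (t * r m)) (pderiv (linear_factors_op t r m P))"

lemma linear_factors_op_preserves:
  assumes "P \<in> hyperbolic_polys n" "Q \<in> hyperbolic_polys n" "Q \<preceq>\<^sub>s P"
  shows "linear_factors_op t r m P \<in> hyperbolic_polys n \<and>
    linear_factors_op t r m Q \<in> hyperbolic_polys n \<and>
    linear_factors_op t r m Q \<preceq>\<^sub>s linear_factors_op t r m P"
proof (induction m)
  case (Suc m)
  then show ?case
    using minus_pderiv_preserves[of "linear_factors_op t r m P" n "linear_factors_op t r m Q" "t * r m"]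
    by (simp del: of_real_mult)
qed (use assms in simp)

text \<open>Reversing the coefficients of \<open>root_poly m r\<close> gives the product of the
  \<open>1 - r j x\<close>, whose value at \<open>t x\<close> is the symbol of the operator.
  Appending a zero multiplies it by one linear factor.\<close>

lemma linear_factors_op_eq_dop:
  "linear_factors_op t r m P =
    dop (\<lambda>k. of_real t ^ k * coeff (reflect_poly (root_poly m r)) k) m P"
proof (induction m)
  case 0
  then show ?case by (simp add: dop_def root_poly_def)
next
  case (Suc m)
  define b where "b m = (\<lambda>k. of_real t ^ k * coeff (reflect_poly (root_poly m r)) k)" for m
  have b: "b m k = of_real t ^ k * coeff (reflect_poly (root_poly m r)) k" for m k
    by (simp add: b_def)
  have "reflect_poly [:- complex_of_real (r m), 1:] = [:1, - complex_of_real (r m):]"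
    by (simp add: reflect_poly_def)
  then have psi: "reflect_poly (root_poly (Suc m) r) =
      reflect_poly (root_poly m r) * [:1, - complex_of_real (r m):]"
    by (simp only: root_poly_Suc reflect_poly_mult)
  have b0: "b (Suc m) 0 = b m 0" by (simp add: b psi)
  have bS: "b (Suc m) (Suc k) = b m (Suc k) - of_real (t * r m) * b m k" for k
    by (simp add: b psi algebra_simps)
  \<comment> \<open>The reversed polynomial has degree at most \<open>m\<close>, so the sum may run
    to \<open>Suc m\<close>, which leaves room for the index shift.\<close>
  have "b m (Suc m) = 0" by (simp add: b coeff_reflect_poly)
  then have "dop (b m) m P = dop (b m) (Suc m) P" by (simp add: dop_def)
  also have "\<dots> = smult (b m 0) P + (\<Sum>k\<le>m. smult (b m (Suc k)) ((pderiv ^^ Suc k) P))"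
    unfolding dop_def by (subst sum.atMost_Suc_shift) simp
  finally have 1: "dop (b m) m P =
      smult (b m 0) P + (\<Sum>k\<le>m. smult (b m (Suc k)) ((pderiv ^^ Suc k) P))" .
  have 2: "pderiv (dop (b m) m P) = (\<Sum>k\<le>m. smult (b m k) ((pderiv ^^ Suc k) P))"
    using higher_pderiv_sum[of 1 "\<lambda>k. smult (b m k) ((pderiv ^^ k) P)" "{..m}"]
    by (simp add: dop_def pderiv_smult)
  have "dop (b (Suc m)) (Suc m) P =
      smult (b (Suc m) 0) P + (\<Sum>k\<le>m. smult (b (Suc m) (Suc k)) ((pderiv ^^ Suc k) P))"
    unfolding dop_def by (subst sum.atMost_Suc_shift) simp
  also have "\<dots> = dop (b m) m P - smult (of_real (t * r m)) (pderiv (dop (b m) m P))"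
    unfolding 2 unfolding 1 b0 bS
    by (simp add: poly_eq_iff coeff_sum left_diff_distrib sum_subtractf sum_distrib_left mult.assoc
        del: funpow.simps)
  also have "dop (b m) m P = linear_factors_op t r m P"
    unfolding b_def by (rule Suc.IH [symmetric])
  finally show ?case unfolding b_def by simp
qed

text \<open>For fixed \<open>k\<close> this is a product of \<open>k\<close> factors tending to 1.
  Writing \<open>N = m + Suc n\<close> keeps \<open>N\<close> positive and the natural subtraction
  \<open>N - k\<close> exact.\<close>

lemma pochhammer_div_power_tendsto:
  assumes "k \<le> n"
  shows "(\<lambda>m. pochhammer (of_nat (Suc (m + Suc n - k))) k / (of_nat (m + Suc n)) ^ k)
    \<longlonglongrightarrow> (1 :: complex)"
proof -
  define c where "c = Suc (Suc n - k)"
  have shift: "Suc (m + Suc n - k) = m + c" for m using assms by (simp add: c_def)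
  have "(\<lambda>m. \<Prod>i<k. (of_nat (m + c) + of_nat i) / of_nat (m + Suc n))
      \<longlonglongrightarrow> (\<Prod>i<k. 1 :: complex)"
  proof (intro tendsto_prod)
    fix i
    have "(\<lambda>m. (real (m + c) + real i) / real (m + Suc n)) \<longlonglongrightarrow> 1"
      by real_asymp
    from tendsto_of_real[OF this, where ?'a = complex]
    show "(\<lambda>m. (of_nat (m + c) + of_nat i) / of_nat (m + Suc n)) \<longlonglongrightarrow> (1 :: complex)"
      by simp
  qed
  then show ?thesis
    unfolding shift by (simp add: pochhammer_prod atLeast0LessThan prod_dividef)
qed

text \<open>With \<open>r\<close> the zeros of \<open>T x\<^sup>N\<close>, the product of the \<open>1 - (r j / N) D\<close> has the symbol of \<open>T\<close>
  with its \<open>k\<close>-th coefficient multiplied by \<open>N (N - 1) \<cdots> (N - k + 1) / N\<^sup>k\<close>.\<close>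

lemma preserver_limit_linear_factors:
  assumes T: "T \<in> hyperbolicity_preservers"
  shows "\<exists>t r. \<forall>P z. degree P \<le> n \<longrightarrow>
    (\<lambda>m. poly (linear_factors_op (t m) (r m) (m + Suc n) P) z) \<longlonglongrightarrow> poly (T P) z"
proof -
  define a where "a = (\<lambda>k. poly (T (monom 1 k)) 0 / fact k)"
  have "\<exists>r. T (monom 1 N) = root_poly N r" for N
  proof -
    have "T (monom 1 N) \<in> hyperbolic_polys N"
      using T monom_1_hyperbolic[of N] by (auto simp: hyperbolicity_preservers_def)
    then show ?thesis by (metis hyperbolic_root_poly)
  qed
  then obtain r where r: "\<And>N. T (monom 1 N) = root_poly N (r N)" by metis
  define t where "t m = 1 / real (m + Suc n)" for m
  define b where "b m k = of_real (t m) ^ k * coeff (reflect_poly (root_poly (m + Suc n) (r (m + Suc n)))) k"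
    for m k
  have dop: "T (monom 1 N) = dop a N (monom 1 N)" for N
    unfolding a_def by (rule preserver_monom_eq_dop[OF T])
  have b: "(\<lambda>m. b m k) \<longlonglongrightarrow> a k" if "k \<le> n" for k
  proof -
    have "b m k = a k * (pochhammer (of_nat (Suc (m + Suc n - k))) k / (of_nat (m + Suc n)) ^ k)" for m
    proof -
      have "coeff (reflect_poly (root_poly (m + Suc n) (r (m + Suc n)))) k =
          coeff (root_poly (m + Suc n) (r (m + Suc n))) (m + Suc n - k)"
        using that by (simp add: coeff_reflect_poly)
      also have "\<dots> = a k * pochhammer (of_nat (Suc (m + Suc n - k))) k"
        unfolding r[symmetric] dop by (rule coeff_dop_monom) (use that in simp)
      finally show ?thesis by (simp only: b_def t_def) (simp add: power_divide)
    qed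
    then show ?thesis
      using tendsto_mult[OF tendsto_const pochhammer_div_power_tendsto[OF that], of "a k"] by simp
  qed
  have "(\<lambda>m. poly (linear_factors_op (t m) (r (m + Suc n)) (m + Suc n) P) z) \<longlonglongrightarrow> poly (T P) z"
    if P: "degree P \<le> n" for P z
  proof -
    \<comment> \<open>On degree at most \<open>n\<close> every product can be cut off after
      \<open>D^n\<close>, so only finitely many coefficient limits are involved although the number
      of factors grows.\<close>
    have "linear_factors_op (t m) (r (m + Suc n)) (m + Suc n) P = dop (b m) n P" for m
      unfolding linear_factors_op_eq_dop b_def using P by (intro dop_degree_less) auto
    moreover have "(\<lambda>m. poly (dop (b m) n P) z) \<longlonglongrightarrow> poly (dop a n P) z"
      unfolding dop_def poly_sum poly_smult by (intro tendsto_intros b) auto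
    moreover have "T P = dop a n P"
      using preserver_eq_dop[OF T P] by (simp add: a_def)
    ultimately show ?thesis by simp
  qed
  then show ?thesis by (intro exI[of _ t] exI[of _ "\<lambda>m. r (m + Suc n)"] allI impI)
qed

theorem corollary2:
  fixes n :: nat and P Q :: "complex poly"
  assumes "n \<ge> 1"
    and "P \<in> hyperbolic_polys n" and "Q \<in> hyperbolic_polys n"
    and "Q \<preceq>\<^sub>s P"
  shows "\<forall>T \<in> hyperbolicity_preservers. T Q \<preceq>\<^sub>s T P"
proof
  fix T assume "T \<in> hyperbolicity_preservers"
  then obtain t r where lim: "\<And>R z. degree R \<le> n \<Longrightarrow>
      (\<lambda>m. poly (linear_factors_op (t m) (r m) (m + Suc n) R) z) \<longlonglongrightarrow> poly (T R) z"
    using preserver_limit_linear_factors[of T n] by blast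
  define S where "S m = linear_factors_op (t m) (r m) (m + Suc n)" for m
  have S: "S m P \<in> hyperbolic_polys n" "S m Q \<in> hyperbolic_polys n" "S m Q \<preceq>\<^sub>s S m P" for m
    unfolding S_def using linear_factors_op_preserves[OF assms(2-4)] by blast+
  have "\<exists>x. S m P = root_poly n x" for m
    by (rule hyperbolic_root_poly[OF S(1)]) blast
  then obtain x where x: "\<And>m. S m P = root_poly n (x m)" by metis
  have "\<exists>y. S m Q = root_poly n y" for m
    by (rule hyperbolic_root_poly[OF S(2)]) blast
  then obtain y where y: "\<And>m. S m Q = root_poly n (y m)" by metis
  have deg: "degree P \<le> n" "degree Q \<le> n"
    using assms by (auto simp: hyperbolic_polys_def)
  \<comment> \<open>Each approximant respects the order and both images converge pointwise, so
    closure under limits applies.\<close>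
  show "T Q \<preceq>\<^sub>s T P"
  proof (rule spectral_le_limit)
    show "maj n (y m) (x m)" for m
      using S(3)[of m] unfolding x y spectral_le_root_poly .
    show "(\<lambda>m. poly (root_poly n (x m)) z) \<longlonglongrightarrow> poly (T P) z" for z
      unfolding x[symmetric] S_def by (rule lim[OF deg(1)])
    show "(\<lambda>m. poly (root_poly n (y m)) z) \<longlonglongrightarrow> poly (T Q) z" for z
      unfolding y[symmetric] S_def by (rule lim[OF deg(2)])
  qed
qed

end
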